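(* Let $\mathbf{k}$ be a field of characteristic zero and let $X$ be a nonempty set. Let $\mathfrak{R}$ be the set of Reynolds words on $X$ and let $\mathbf{k}\mathfrak{R}$ be the $\mathbf{k}$-vector space with basis $\mathfrak{R}$. With the concatenation multiplication and with the linear operator $P:\mathbf{k}\mathfrak{R}\to\mathbf{k}\mathfrak{R}$ defined in the context, the pair $(\mathbf{k}\mathfrak{R},P)$ is a Reynolds algebra.
   Context: All algebras are unitary associative $\mathbf{k}$-algebras. A Reynolds algebra over $\mathbf{k}$ is a pair $(R,P)$ with $R$ a $\mathbf{k}$-algebra and $P:R\to R$ a $\mathbf{k}$-linear map satisfying the Reynolds identity $P(u)P(v)=P(uP(v))+P(P(u)v)-P(P(u)P(v))$ for all $u,v\in R$. Bracketed words. For a set $Y$ let $M(Y)$ be the free monoid on $Y$ with identity $\mathbf{1}$, and let $\lfloor Y\rfloor=\{\lfloor y\rfloor : y\in Y\}$ be a copy of $Y$ disjoint from $Y$. Put $\mathfrak{M}_0=M(X)$ and $\mathfrak{M}_n=M(X\sqcup\lfloor\mathfrak{M}_{n-1}\rfloor)$ for $n\ge1$, with the natural inclusions $\mathfrak{M}_{n-1}\hookrightarrow\mathfrak{M}_n$, and $\mathfrak{M}(X)=\varinjlim\mathfrak{M}_n$, so that $\mathfrak{M}(X)=M(X\sqcup\lfloor\mathfrak{M}(X)\rfloor)$. Elements of $\mathfrak{M}(X)$ are called bracketed words. Reynolds words. A bracketed word is a Reynolds word if it contains no subword of the form $\lfloor\lfloor u_1\rfloor\cdots\lfloor u_n\rfloor\rfloor$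 with $n\ge2$ and $u_1,\dots,u_n\in\mathfrak{M}(X)$. Let $\mathfrak{R}$ be the set of Reynolds words. Let $\mathfrak{R}''\subseteq\mathfrak{R}$ be the set of Reynolds words of the form $\lfloor s_1\rfloor\cdots\lfloor s_m\rfloor$ with $m\ge2$ and $s_j\in\mathfrak{R}$, and let $\mathfrak{R}'=\mathfrak{R}\setminus\mathfrak{R}''$. Then $\mathfrak{R}=M(X\sqcup\lfloor\mathfrak{R}'\rfloor)$; in particular $\mathfrak{R}$ is closed under concatenation, and $\lfloor r\rfloor\in\mathfrak{R}$ for $r\in\mathfrak{R}'$. The product on $\mathbf{k}\mathfrak{R}$ is the bilinear extension of concatenation. The operator $P$. Write $\lfloor r\rfloor^{(n)}$ for $n$ nested brackets around $r$ (so $\lfloor r\rfloor^{(0)}=r$). The linear map $P:\mathbf{k}\mathfrak{R}\to\mathbf{k}\mathfrak{R}$ is defined on the basis $\mathfrak{R}$ as follows. If $r\in\mathfrak{R}'$, then $P(r)=\lfloor r\rfloor$. If $r\in\mathfrak{R}''$, write uniquely $r=\lfloor r_1\rfloor^{(n_1)}\cdots\lfloor r_m\rfloor^{(n_m)}$ with $m\ge2$, $n_j\ge1$ and $r_j\in\mathfrak{R}'\setminus\lfloor\mathfrak{R}'\rfloor$, and define, recursively on $n_1+\cdots+n_m$, $$P(r)=\frac1{m-1}\Big(\sum_{i=1}^m P\big(\lfloor r_1\rfloor^{(n_1)}\cdots\lfloor r_{i-1}\rfloor^{(n_{i-1})}\lfloor r_i\rfloor^{(n_i-1)}\lfloor r_{i+1}\rfloor^{(n_{i+1})}\cdots\lfloor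 r_m\rfloor^{(n_m)}\big)-r\Big).$$ *)

theory Defs
  imports Complex_Main "HOL-Library.Poly_Mapping"
begin

section \<open>Reynolds algebras\<close>

text \<open>
  The sort \<open>{ring, monoid_mult}\<close> is that of associative rings with unit; unlike \<open>ring_1\<close> it
  does not exclude the zero ring.
\<close>

locale unital_algebra = vector_space scale
  for scale :: "'k::field \<Rightarrow> 'a::{ring, monoid_mult} \<Rightarrow> 'a" +
  assumes scale_mult_left: "scale c x * y = scale c (x * y)"
    and scale_mult_right: "x * scale c y = scale c (x * y)"

locale reynolds_algebra = unital_algebra scale
  for scale :: "'k::field \<Rightarrow> 'a::{ring, monoid_mult} \<Rightarrow> 'a" +
  fixes P :: "'a \<Rightarrow> 'a"
  assumes linear_P: "Vector_Spaces.linear scale scale P"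
    and reynolds_identity: "P u * P v = P (u * P v) + P (P u * v) - P (P u * P v)"


section \<open>Bracketed words\<close>

text \<open>
  The least solution of \<open>W = M(X + \<lfloor>W\<rfloor>)\<close>, where \<open>X\<close> is the type \<open>'x\<close> of variables and the free
  monoid is given by lists.
\<close>

datatype 'x letter = Var 'x | Br "'x letter list"

type_synonym 'x bword = "'x letter list"

text \<open>Subwords may occur at any bracket depth.\<close>

inductive subword :: "'x bword \<Rightarrow> 'x bword \<Rightarrow> bool" for v where
  top: "subword v (a @ v @ b)"
| inside: "subword v u \<Longrightarrow> subword v (a @ [Br u] @ b)"

text \<open>\<open>Rey\<close>, \<open>Rey1\<close>, \<open>Rey2\<close> are the sets \<open>R\<close> of Reynolds words, \<open>R'\<close> and \<open>R''\<close>. The word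
  \<open>[Br (map Br us)]\<close> is \<open>\<lfloor>\<lfloor>u\<^sub>1\<rfloor>\<dots>\<lfloor>u\<^sub>n\<rfloor>\<rfloor>\<close>.\<close>

definition Rey :: "'x bword set" where
  "Rey = {w. \<nexists>us. length us \<ge> 2 \<and> subword [Br (map Br us)] w}"

definition Rey2 :: "'x bword set" where
  "Rey2 = {w \<in> Rey. \<exists>ss. length ss \<ge> 2 \<and> set ss \<subseteq> Rey \<and> w = map Br ss}"

definition Rey1 :: "'x bword set" where
  "Rey1 = Rey - Rey2"

definition nest :: "nat \<Rightarrow> 'x bword \<Rightarrow> 'x bword" where
  "nest n r = ((\<lambda>w. [Br w]) ^^ n) r"

text \<open>The list \<open>[(r\<^sub>1, n\<^sub>1), \<dots>, (r\<^sub>m, n\<^sub>m)]\<close> encodes the concatenation of the words \<open>r\<^sub>j\<close>, each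
  enclosed in \<open>n\<^sub>j\<close> nested brackets.\<close>

definition nest_word :: "('x bword \<times> nat) list \<Rightarrow> 'x bword" where
  "nest_word ps = concat (map (\<lambda>(r, n). nest n r) ps)"

definition is_decomp :: "'x bword \<Rightarrow> ('x bword \<times> nat) list \<Rightarrow> bool" where
  "is_decomp w ps \<longleftrightarrow> length ps \<ge> 2 \<and>
     (\<forall>(r, n) \<in> set ps. n \<ge> 1 \<and> r \<in> Rey1 - (\<lambda>s. [Br s]) ` Rey1) \<and> w = nest_word ps"

definition decomp :: "'x bword \<Rightarrow> ('x bword \<times> nat) list" where
  "decomp w = (THE ps. is_decomp w ps)"

lemma subword_refl: "subword v v"
  using subword.top[of v "[]" "[]"] by simp

lemma subword_Br: "subword v u \<Longrightarrow> Br u \<in> set w \<Longrightarrow> subword v w"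
  using subword.inside[of v u] by (auto simp: in_set_conv_decomp)

lemma subword_single_iff:
  "subword [l] w \<longleftrightarrow> l \<in> set w \<or> (\<exists>u. Br u \<in> set w \<and> subword [l] u)"
proof
  show "subword [l] w \<Longrightarrow> l \<in> set w \<or> (\<exists>u. Br u \<in> set w \<and> subword [l] u)"
    by (cases rule: subword.cases) auto
  show "l \<in> set w \<or> (\<exists>u. Br u \<in> set w \<and> subword [l] u) \<Longrightarrow> subword [l] w"
  proof (elim disjE exE conjE)
    assume "l \<in> set w"
    then obtain a b where "w = a @ [l] @ b" by (auto simp: in_set_conv_decomp)
    then show ?thesis using subword.top by blast
  qed (auto intro: subword_Br)
qed

lemma Rey_Nil: "[] \<in> Rey"
  unfolding Rey_def by (subst subword_single_iff) simp

lemma Rey_append_iff: "u @ v \<in> Rey \<longleftrightarrow> u \<in> Rey \<and> v \<in> Rey"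
proof -
  have "subword [l] (u @ v) \<longleftrightarrow> subword [l] u \<or> subword [l] v" for l
    by (subst (1 2 3) subword_single_iff) auto
  then show ?thesis unfolding Rey_def by auto
qed

lemma Rey_Br_mem: "w \<in> Rey \<Longrightarrow> Br s \<in> set w \<Longrightarrow> s \<in> Rey"
  unfolding Rey_def using subword_Br by blast

lemma Rey_Br_iff: "[Br s] \<in> Rey \<longleftrightarrow> s \<in> Rey1"
proof
  assume h: "[Br s] \<in> Rey"
  then have "s \<in> Rey" using Rey_Br_mem by fastforce
  moreover have "s \<notin> Rey2"
  proof
    assume "s \<in> Rey2"
    then obtain ss where "length ss \<ge> 2" "s = map Br ss" unfolding Rey2_def by auto
    with h show False unfolding Rey_def using subword_refl by blast
  qed
  ultimately show "s \<in> Rey1" by (simp add: Rey1_def)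
next
  assume h: "s \<in> Rey1"
  show "[Br s] \<in> Rey"
  proof (rule ccontr)
    assume "[Br s] \<notin> Rey"
    then obtain us where us: "length us \<ge> 2" "subword [Br (map Br us)] [Br s]"
      unfolding Rey_def by auto
    from us(2) have "map Br us = s \<or> subword [Br (map Br us)] s"
      by (subst (asm) subword_single_iff) auto
    with us(1) h have "s = map Br us" by (auto simp: Rey1_def Rey_def)
    with us(1) h Rey_Br_mem[of s] have "s \<in> Rey2" by (auto simp: Rey1_def Rey2_def)
    with h show False by (simp add: Rey1_def)
  qed
qed

lemma Rey1_Br_iff: "[Br s] \<in> Rey1 \<longleftrightarrow> s \<in> Rey1"
  using Rey_Br_iff[of s] by (auto simp: Rey1_def Rey2_def Cons_eq_map_conv)

lemma nest_0 [simp]: "nest 0 r = r"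
  and nest_Suc [simp]: "nest (Suc n) r = [Br (nest n r)]"
  by (simp_all add: nest_def)

lemma nest_Rey1: "r \<in> Rey1 \<Longrightarrow> nest n r \<in> Rey1"
  by (induction n) (auto simp: Rey1_Br_iff)

lemma nest_exists:
  "s \<in> Rey1 \<Longrightarrow> \<exists>r n. n \<ge> 1 \<and> r \<in> Rey1 - (\<lambda>s. [Br s]) ` Rey1 \<and> [Br s] = nest n r"
proof (induction "size_list size s" arbitrary: s rule: less_induct)
  case less
  show ?case
  proof (cases "s \<in> (\<lambda>s. [Br s]) ` Rey1")
    case True
    then obtain t where t: "t \<in> Rey1" "s = [Br t]" by auto
    with less.hyps[of t] obtain r n
      where "r \<in> Rey1 - (\<lambda>s. [Br s]) ` Rey1" "[Br t] = nest n r" by auto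
    with t show ?thesis by (intro exI[of _ r] exI[of _ "Suc n"]) auto
  next
    case False
    with less.prems show ?thesis by (intro exI[of _ s] exI[of _ "1::nat"]) auto
  qed
qed

lemma nest_unique:
  assumes "r \<in> Rey1 - (\<lambda>s. [Br s]) ` Rey1" "r' \<in> Rey1 - (\<lambda>s. [Br s]) ` Rey1"
    and "nest n r = nest n' r'"
  shows "r = r' \<and> n = n'"
  using assms(3)
proof (induction n arbitrary: n')
  case 0
  then show ?case using assms nest_Rey1[of r'] by (cases n') auto
next
  case (Suc n)
  then show ?case using assms nest_Rey1[of r] by (cases n') auto
qed

lemma ex1_decomp:
  assumes "w \<in> Rey2"
  shows "\<exists>!ps. is_decomp w ps"
proof -
  let ?Q = "\<lambda>(r, n). n \<ge> (1::nat) \<and> r \<in> Rey1 - (\<lambda>s. [Br s]) ` Rey1"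
  let ?f = "\<lambda>(r, n). nest n r"
  obtain ss where ss: "length ss \<ge> 2" "w = map Br ss" using assms by (auto simp: Rey2_def)
  have "s \<in> Rey1" if s: "s \<in> set ss" for s
  proof -
    obtain a b where "ss = a @ s # b" using s by (auto simp: in_set_conv_decomp)
    with assms ss(2) have "map Br a @ [Br s] @ map Br b \<in> Rey" by (simp add: Rey2_def)
    then show ?thesis by (simp only: Rey_append_iff Rey_Br_iff)
  qed
  then have "\<forall>s\<in>set ss. \<exists>p. ?Q p \<and> [Br s] = ?f p" using nest_exists by fastforce
  then obtain g where g: "\<And>s. s \<in> set ss \<Longrightarrow> ?Q (g s) \<and> [Br s] = ?f (g s)" by metis
  have "concat (map ?f (map g ss)) = map Br ss"
    using g by (induction ss) (auto simp: split_def)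
  then have ex: "is_decomp w (map g ss)"
    using ss g by (auto simp: is_decomp_def nest_word_def split_def)
  have uniq: "\<forall>p\<in>set ps. ?Q p \<Longrightarrow> \<forall>p\<in>set qs. ?Q p \<Longrightarrow> nest_word ps = nest_word qs \<Longrightarrow> ps = qs"
    for ps qs :: "('a bword \<times> nat) list"
  proof (induction ps arbitrary: qs)
    case Nil
    show ?case
    proof (cases qs)
      case (Cons q qs')
      with Nil show ?thesis by (cases "snd q") (auto simp: nest_word_def split_def)
    qed simp
  next
    case (Cons p ps)
    obtain r n where p: "p = (r, Suc n)" using Cons.prems(1)
      by (cases p; cases "snd p") auto
    show ?case
    proof (cases qs)
      case Nil
      with Cons.prems p show ?thesis by (auto simp: nest_word_def)
    next
      case qs: (Cons q qs')
      obtain r' n' where q: "q = (r', Suc n')" using Cons.prems(2) qs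
        by (cases q; cases "snd q") auto
      have "nest n r = nest n' r'" "nest_word ps = nest_word qs'"
        using Cons.prems(3) p q qs by (auto simp: nest_word_def)
      moreover have "r = r' \<and> n = n'"
        using Cons.prems(1,2) p q qs \<open>nest n r = nest n' r'\<close> by (intro nest_unique) auto
      ultimately show ?thesis using Cons.IH[of qs'] Cons.prems(1,2) p q qs by auto
    qed
  qed
  show ?thesis
  proof (rule ex1I[of _ "map g ss"])
    show "is_decomp w ps \<Longrightarrow> ps = map g ss" for ps
      using ex uniq[of ps "map g ss"] unfolding is_decomp_def by auto
  qed (rule ex)
qed

lemma is_decomp_decomp: "w \<in> Rey2 \<Longrightarrow> is_decomp w (decomp w)"
  unfolding decomp_def by (rule theI') (rule ex1_decomp)


section \<open>The algebra on Reynolds words\<close>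

typedef 'x rword = "Rey :: 'x bword set"
  morphisms bword_of rword_of
  using Rey_Nil by auto

text \<open>
  Concatenation is written additively: the library's multiplication on
  \<open>'x rword \<Rightarrow>\<^sub>0 'k\<close> is the convolution product over an additive monoid of exponents, that is, the
  bilinear extension of concatenation.
\<close>

instantiation rword :: (type) monoid_add
begin

definition zero_rword :: "'a rword" where
  "0 = rword_of []"

definition plus_rword :: "'a rword \<Rightarrow> 'a rword \<Rightarrow> 'a rword" where
  "u + v = rword_of (bword_of u @ bword_of v)"

instance
proof
  fix a b c :: "'a rword"
  have [simp]: "bword_of (u + v) = bword_of u @ bword_of v" for u v :: "'a rword"
    using bword_of[of u] bword_of[of v]
    by (simp add: plus_rword_def rword_of_inverse Rey_append_iff)
  have [simp]: "bword_of (0 :: 'a rword) = []"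
    by (simp add: zero_rword_def rword_of_inverse Rey_Nil)
  show "a + b + c = a + (b + c)" "0 + a = a" "a + 0 = a"
    by (simp_all add: bword_of_inject[symmetric])
qed

end

definition scale_kR :: "'k::field \<Rightarrow> ('x rword \<Rightarrow>\<^sub>0 'k) \<Rightarrow> ('x rword \<Rightarrow>\<^sub>0 'k)" where
  "scale_kR c f = Poly_Mapping.map ((*) c) f"

lemma size_list_append': "size_list f (xs @ ys) = size_list f xs + size_list f ys"
  by (induction xs) auto

text \<open>\<open>Pword r\<close> is the value of the operator at a basis word \<open>r \<in> Rey\<close>; values at words outside
  \<open>Rey\<close> are irrelevant.\<close>

function Pword :: "'x bword \<Rightarrow> ('x rword \<Rightarrow>\<^sub>0 'k::field)" where
  "Pword r =
    (if r \<in> Rey2 then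
       (let ps = decomp r; m = length ps in
         scale_kR (1 / of_nat (m - 1))
           ((\<Sum>i<m. Pword (nest_word (ps[i := (fst (ps ! i), snd (ps ! i) - 1)])))
             - Poly_Mapping.single (rword_of r) 1))
     else Poly_Mapping.single (rword_of [Br r]) 1)"
  by auto
termination
proof (relation "measure (size_list size)", goal_cases)
  case (2 r ps m i)
  then have d: "is_decomp r ps" and i: "i < length ps"
    using is_decomp_decomp by auto
  obtain s n where s: "ps ! i = (s, Suc n)"
    using d i nth_mem[OF i] unfolding is_decomp_def
    by (cases "ps ! i"; cases "snd (ps ! i)") auto
  have "r = nest_word (take i ps @ (s, Suc n) # drop (Suc i) ps)"
    using d i s by (metis is_decomp_def id_take_nth_drop)
  then show ?case
    using i s by (simp add: nest_word_def upd_conv_take_nth_drop size_list_append')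
qed simp

declare Pword.simps [simp del]

definition reynolds_P :: "('x rword \<Rightarrow>\<^sub>0 'k::field) \<Rightarrow> ('x rword \<Rightarrow>\<^sub>0 'k)" where
  "reynolds_P f =
    (\<Sum>w\<in>Poly_Mapping.keys f. scale_kR (Poly_Mapping.lookup f w) (Pword (bword_of w)))"

end

theory Submission
  imports Defs
begin

text \<open>
  Let \<open>d\<close> be the derivation of the concatenation algebra with \<open>d \<lfloor>s\<rfloor> = s - \<lfloor>s\<rfloor>\<close> on bracketed
  letters and \<open>d x = 0\<close> on variables, and put \<open>T f = f + d f\<close>, so that
  \<open>T (f g) = T f \<cdot> g + f \<cdot> T g - f g\<close>. On a product \<open>w\<close> of \<open>m \<ge> 1\<close> brackets, \<open>T w\<close> is the sum of
  the words obtained by removing one outer bracket, minus \<open>(m - 1) w\<close>. The recursion defining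
  \<open>P\<close> therefore says that \<open>P (T w) = w\<close>, and induction along it gives \<open>T (P f) = f\<close> for all \<open>f\<close>.
  Since \<open>P u\<close>, \<open>P v\<close> and \<open>P u \<cdot> P v\<close> are combinations of nonempty products of brackets,
  \<open>P u \<cdot> P v = P (T (P u \<cdot> P v)) = P (u \<cdot> P v + P u \<cdot> v - P u \<cdot> P v)\<close>.
\<close>

section \<open>The unital algebra on Reynolds words\<close>

lemma scale_kR_eq_mult: "scale_kR c f = Poly_Mapping.single 0 c * f"
  by (simp add: scale_kR_def mult_map_scale_conv_mult)

lemma lookup_scale_kR: "Poly_Mapping.lookup (scale_kR c f) w = c * Poly_Mapping.lookup f w"
  by (simp add: scale_kR_def map.rep_eq when_def)

interpretation kR: unital_algebra scale_kR
proof
  fix c d :: 'a and f g :: "'b rword \<Rightarrow>\<^sub>0 'a"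
  show "scale_kR c (f + g) = scale_kR c f + scale_kR c g"
    and "scale_kR (c + d) f = scale_kR c f + scale_kR d f"
    and "scale_kR c (scale_kR d f) = scale_kR (c * d) f"
    and "scale_kR 1 f = f"
    by (auto intro!: poly_mapping_eqI simp: lookup_scale_kR lookup_add algebra_simps)
  show "scale_kR c f * g = scale_kR c (f * g)"
    by (simp add: scale_kR_eq_mult mult.assoc)
  \<comment> \<open>Scalars sit on the empty word, which is neutral on both sides, so they are
    central although concatenation is not commutative. The induction adds one monomial at a
    time.\<close>
  have comm: "f * Poly_Mapping.single 0 c = Poly_Mapping.single 0 c * f"
  proof (induction f rule: update_induct)
    case (update f a b)
    have "Poly_Mapping.update a b f = f + Poly_Mapping.single a b"
      using update.hyps
      by (auto intro!: poly_mapping_eqI simp: lookup_update lookup_add lookup_single when_def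
          in_keys_iff)
    then show ?case
      using update.IH by (simp add: distrib_left distrib_right mult_single mult.commute)
  qed simp
  show "f * scale_kR c g = scale_kR c (f * g)"
    by (simp add: scale_kR_eq_mult mult.assoc[symmetric] comm)
qed

interpretation kR: vector_space_pair scale_kR scale_kR ..

section \<open>Linear maps given by their values on words\<close>

abbreviation kR_linear ::
    "(('x rword \<Rightarrow>\<^sub>0 'k::field) \<Rightarrow> ('x rword \<Rightarrow>\<^sub>0 'k)) \<Rightarrow> bool" where
  "kR_linear \<equiv> Vector_Spaces.linear scale_kR scale_kR"

lemma kR_linear_iff:
  "kR_linear f \<longleftrightarrow> (\<forall>x y. f (x + y) = f x + f y) \<and> (\<forall>c x. f (scale_kR c x) = scale_kR c (f x))"
  using kR.vector_space_axioms by (auto simp: Vector_Spaces.linear_iff)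

definition lin_ext :: "('x rword \<Rightarrow> ('x rword \<Rightarrow>\<^sub>0 'k::field)) \<Rightarrow> ('x rword \<Rightarrow>\<^sub>0 'k) \<Rightarrow> ('x rword \<Rightarrow>\<^sub>0 'k)"
  where "lin_ext h f = (\<Sum>w\<in>Poly_Mapping.keys f. scale_kR (Poly_Mapping.lookup f w) (h w))"

text \<open>Coefficients off the support vanish. A common finite index set lets sums over different
  supports be compared, which gives additivity.\<close>

lemma lin_ext_superset:
  assumes "finite K" "Poly_Mapping.keys f \<subseteq> K"
  shows "lin_ext h f = (\<Sum>w\<in>K. scale_kR (Poly_Mapping.lookup f w) (h w))"
  unfolding lin_ext_def using assms
  by (intro sum.mono_neutral_left) (auto simp: in_keys_iff)

lemma linear_lin_ext:
  fixes h :: "'x rword \<Rightarrow> ('x rword \<Rightarrow>\<^sub>0 'k::field)"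
  shows "kR_linear (lin_ext h)"
  unfolding kR_linear_iff
proof (intro conjI allI)
  fix f g :: "'x rword \<Rightarrow>\<^sub>0 'k"
  let ?K = "Poly_Mapping.keys f \<union> Poly_Mapping.keys g"
  show "lin_ext h (f + g) = lin_ext h f + lin_ext h g"
    using keys_add[of f g]
    by (simp add: lin_ext_superset[of ?K] lookup_add kR.scale_left_distrib sum.distrib)
next
  fix c :: 'k and f :: "'x rword \<Rightarrow>\<^sub>0 'k"
  have "Poly_Mapping.keys (scale_kR c f) \<subseteq> Poly_Mapping.keys f"
    by (auto simp: in_keys_iff lookup_scale_kR)
  then show "lin_ext h (scale_kR c f) = scale_kR c (lin_ext h f)"
    by (simp add: lin_ext_superset[of "Poly_Mapping.keys f"] lookup_scale_kR kR.scale_sum_right)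
qed

lemma lin_ext_single [simp]: "lin_ext h (Poly_Mapping.single w 1) = h w"
  by (simp add: lin_ext_def)

text \<open>Bare words allow recursion over letters. As \<open>rword_of\<close> is specified only on
  \<open>Rey\<close>, later facts carry membership hypotheses.\<close>

definition monom :: "'x bword \<Rightarrow> ('x rword \<Rightarrow>\<^sub>0 'k::field)" where
  "monom w = Poly_Mapping.single (rword_of w) 1"

lemma lin_ext_monom: "w \<in> Rey \<Longrightarrow> lin_ext (\<lambda>w. h (bword_of w)) (monom w) = h w"
  by (simp add: monom_def rword_of_inverse)

lemma monom_append: "u \<in> Rey \<Longrightarrow> v \<in> Rey \<Longrightarrow> monom (u @ v) = monom u * monom v"
  by (simp add: monom_def mult_single plus_rword_def rword_of_inverse)

lemma monom_Nil: "monom [] = 1"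
  by (simp add: monom_def flip: zero_rword_def)

lemma in_span_monom: "f \<in> kR.span (monom ` Rey)"
proof -
  have "f = (\<Sum>w\<in>Poly_Mapping.keys f. scale_kR (Poly_Mapping.lookup f w) (monom (bword_of w)))"
    by (intro poly_mapping_eqI)
      (simp add: lookup_sum lookup_scale_kR monom_def bword_of_inverse lookup_single when_def
        in_keys_iff if_distrib[of "(*) _"] cong: if_cong)
  moreover have "\<dots> \<in> kR.span (monom ` Rey)"
    by (intro kR.span_sum kR.span_scale kR.span_base imageI bword_of)
  ultimately show ?thesis by simp
qed

lemma kR_linear_eqI:
  assumes "kR_linear F" "kR_linear G" "\<And>w. w \<in> Rey \<Longrightarrow> F (monom w) = G (monom w)"
  shows "F f = G f"
  using kR.linear_eq_on_span[OF assms(1,2) _ in_span_monom] assms(3) by blast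


section \<open>The derivation and its associated twisted derivation\<close>

fun deriv_letter :: "'x letter \<Rightarrow> ('x rword \<Rightarrow>\<^sub>0 'k::field)" where
  "deriv_letter (Var x) = 0"
| "deriv_letter (Br s) = monom s - monom [Br s]"

fun deriv_word :: "'x bword \<Rightarrow> ('x rword \<Rightarrow>\<^sub>0 'k::field)" where
  "deriv_word [] = 0"
| "deriv_word (l # w) = deriv_letter l * monom w + monom [l] * deriv_word w"

text \<open>The Leibniz rule passes from letters to words because the parts of a Reynolds word are
  Reynolds words, so \<open>monom\<close> turns each concatenation into a product.\<close>

lemma deriv_word_append:
  assumes "u \<in> Rey" "v \<in> Rey"
  shows "deriv_word (u @ v) = deriv_word u * monom v + monom u * deriv_word v"
  using assms(1)
proof (induction u rule: list.induct)
  case (Cons l u)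
  then have "[l] \<in> Rey" "u \<in> Rey"
    using Rey_append_iff[of "[l]" u] by auto
  then show ?case
    using Cons.IH assms(2)
    by (simp add: monom_append[of "[l]" u, simplified] monom_append[of u v] algebra_simps)
qed (simp add: monom_Nil)

definition twist :: "('x rword \<Rightarrow>\<^sub>0 'k::field) \<Rightarrow> ('x rword \<Rightarrow>\<^sub>0 'k)" where
  "twist = lin_ext (\<lambda>w. monom (bword_of w) + deriv_word (bword_of w))"

lemma linear_twist: "kR_linear twist"
  unfolding twist_def by (rule linear_lin_ext)

lemma twist_monom: "w \<in> Rey \<Longrightarrow> twist (monom w) = monom w + deriv_word w"
  unfolding twist_def by (rule lin_ext_monom)

text \<open>Both sides are bilinear, so words suffice. There \<open>d\<close> obeys the Leibniz
  rule, and the identity part of \<open>twist\<close> contributes \<open>f * g\<close> once on the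
  left but twice in the first two terms on the right, whence the correction.\<close>

lemma twist_mult: "twist (f * g) = twist f * g + f * twist g - f * g"
proof -
  note T = linear_twist[unfolded kR_linear_iff]
  have "twist (monom u * g) = twist (monom u) * g + monom u * twist g - monom u * g"
    if u: "u \<in> Rey" for u
  proof (rule kR_linear_eqI[of _ _ g])
    fix v :: "'a bword" assume "v \<in> Rey"
    with u show "twist (monom u * monom v) =
        twist (monom u) * monom v + monom u * twist (monom v) - monom u * monom v"
      using Rey_append_iff[of u v]
      by (simp add: twist_monom deriv_word_append algebra_simps flip: monom_append)
  qed (simp_all add: T kR_linear_iff kR.scale_mult_left kR.scale_mult_right
      kR.scale_right_distrib kR.scale_right_diff_distrib algebra_simps)
  then show ?thesis
    by (intro kR_linear_eqI[of "\<lambda>f. twist (f * g)" _ f])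
      (simp_all add: T kR_linear_iff kR.scale_mult_left kR.scale_mult_right
        kR.scale_right_distrib kR.scale_right_diff_distrib algebra_simps)
qed

text \<open>Single brackets are included, being the values of \<open>P\<close> on
  \<open>Rey1\<close>. The empty word must stay out: \<open>twist\<close> fixes it, while
  \<open>P\<close> sends it to \<open>[Br []]\<close>.\<close>

abbreviation bracket_words :: "'x bword set" where
  "bracket_words \<equiv> {map Br ss | ss. ss \<noteq> []} \<inter> Rey"

abbreviation unbracket :: "'x bword list \<Rightarrow> nat \<Rightarrow> 'x bword" where
  "unbracket ss i \<equiv> map Br (take i ss) @ ss ! i @ map Br (drop (Suc i) ss)"

lemma Rey_map_Br_iff: "map Br ss \<in> Rey \<longleftrightarrow> set ss \<subseteq> Rey1"
proof (induction ss)
  case (Cons s ss)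
  then show ?case
    using Rey_append_iff[of "[Br s]" "map Br ss"] by (simp add: Rey_Br_iff)
qed (simp add: Rey_Nil)

lemma unbracket_Rey:
  assumes "map Br ss \<in> Rey" "i < length ss"
  shows "unbracket ss i \<in> Rey"
proof -
  have "set ss \<subseteq> Rey1" using assms(1) by (simp add: Rey_map_Br_iff)
  moreover from this have "ss ! i \<in> Rey" using assms(2) by (auto simp: Rey1_def dest: nth_mem)
  ultimately show ?thesis
    using set_take_subset[of i ss] set_drop_subset[of "Suc i" ss]
    by (auto simp: Rey_append_iff Rey_map_Br_iff)
qed

lemma deriv_word_bracket:
  assumes "map Br ss \<in> Rey"
  shows "deriv_word (map Br ss) =
    (\<Sum>i<length ss. monom (unbracket ss i)) - scale_kR (of_nat (length ss)) (monom (map Br ss))"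
  using assms
proof (induction ss)
  case (Cons s ss)
  then have R: "[Br s] \<in> Rey" "s \<in> Rey" "map Br ss \<in> Rey"
    using Rey_map_Br_iff[of "s # ss"] Rey_map_Br_iff[of ss] Rey_map_Br_iff[of "[s]"]
    by (auto simp: Rey1_def)
  have split: "monom (Br s # w) = monom [Br s] * monom w" if "w \<in> Rey" for w
    using monom_append[OF R(1) that] by simp
  \<comment> \<open>Index 0 in the sum for \<open>s # ss\<close> comes from differentiating
    \<open>Br s\<close>; the indices \<open>Suc i\<close> are the removals in \<open>ss\<close> with
    \<open>Br s\<close> put in front.\<close>
  have hoist: "(\<Sum>i<length ss. monom (Br s # unbracket ss i)) =
      monom [Br s] * (\<Sum>i<length ss. monom (unbracket ss i))"
    using unbracket_Rey[OF R(3)] by (simp add: split sum_distrib_left)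
  show ?case
    using R
    by (simp add: hoist Cons.IH sum.lessThan_Suc_shift split monom_append kR.scale_left_distrib
        kR.scale_mult_right algebra_simps del: sum.lessThan_Suc)
qed simp


section \<open>The operator inverts the twisted derivation\<close>

text \<open>Passes from nesting depths to the list of bracket contents: lowering the exponent of a
  factor by one strips exactly its outermost bracket.\<close>

lemma decomp_bracket:
  assumes "map Br ss \<in> Rey2"
  defines "ps \<equiv> decomp (map Br ss)"
  shows "length ps = length ss"
    and "i < length ss \<Longrightarrow> nest_word (ps[i := (fst (ps ! i), snd (ps ! i) - 1)]) = unbracket ss i"
proof -
  have d: "is_decomp (map Br ss) ps"
    unfolding ps_def using assms(1) by (rule is_decomp_decomp)
  \<comment> \<open>\<open>t p\<close> is the content of the outermost bracket of the factor
    \<open>p\<close>; the truncated subtraction is safe since exponents in a decomposition are at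
    least 1.\<close>
  define t where "t = (\<lambda>p :: 'a bword \<times> nat. nest (snd p - 1) (fst p))"
  have t: "(case p of (r, n) \<Rightarrow> nest n r) = [Br (t p)]" if "p \<in> set ps" for p
    using d that unfolding is_decomp_def t_def by (cases p; cases "snd p") auto
  have nw: "nest_word qs = map Br (map t qs)" if "set qs \<subseteq> set ps" for qs
    using that t by (induction qs) (auto simp: nest_word_def)
  have ss: "ss = map t ps"
    using d nw[of ps] by (auto simp: is_decomp_def inj_map_eq_map inj_def simp flip: map_map simp del: map_map)
  then show "length ps = length ss" by simp
  assume i: "i < length ss"
  have "nest_word (ps[i := (fst (ps ! i), snd (ps ! i) - 1)]) =
      nest_word (take i ps) @ t (ps ! i) @ nest_word (drop (Suc i) ps)"
    using i ss by (simp add: upd_conv_take_nth_drop nest_word_def t_def)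
  then show "nest_word (ps[i := (fst (ps ! i), snd (ps ! i) - 1)]) = unbracket ss i"
    using i ss nw[of "take i ps"] nw[of "drop (Suc i) ps"]
    by (simp add: set_take_subset set_drop_subset take_map drop_map)
qed

lemma Rey2_iff: "w \<in> Rey2 \<longleftrightarrow> w \<in> Rey \<and> (\<exists>ss. length ss \<ge> 2 \<and> w = map Br ss)"
  using Rey_map_Br_iff unfolding Rey2_def Rey1_def by blast

lemma Pword_Rey1: "r \<in> Rey1 \<Longrightarrow> Pword r = monom [Br r]"
  by (subst Pword.simps) (simp add: Rey1_def monom_def)

lemma Pword_bracket:
  assumes "map Br ss \<in> Rey" "length ss \<ge> 2"
  shows "Pword (map Br ss) = scale_kR (1 / of_nat (length ss - 1))
    ((\<Sum>i<length ss. Pword (unbracket ss i)) - monom (map Br ss))"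
proof -
  have R2: "map Br ss \<in> Rey2" using assms by (auto simp: Rey2_iff)
  then show ?thesis
    by (subst Pword.simps) (simp add: Let_def decomp_bracket monom_def del: One_nat_def)
qed

lemma size_unbracket:
  assumes "i < length ss"
  shows "size_list size (unbracket ss i) < size_list size (map Br ss)"
proof -
  have "size_list size (unbracket ss i) <
      size_list size (map Br (take i ss @ ss ! i # drop (Suc i) ss))"
    by (simp add: size_list_append')
  then show ?thesis using assms by (simp only: flip: id_take_nth_drop)
qed

lemma Rey_cases_P [consumes 1, case_names Rey1 bracket]:
  assumes "w \<in> Rey"
  obtains "w \<in> Rey1" | ss where "w = map Br ss" "map Br ss \<in> Rey" "length ss \<ge> 2"
  using assms by (auto simp: Rey1_def Rey2_iff)

text \<open>Induction along the recursion for \<open>P\<close>. Removing a bracket may lead to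
  either class of words, so total size serves as the measure.\<close>

lemma Rey_induct_P [consumes 1, case_names Rey1 bracket]:
  assumes "w \<in> Rey"
    and "\<And>w. w \<in> Rey1 \<Longrightarrow> Q w"
    and "\<And>ss. map Br ss \<in> Rey \<Longrightarrow> length ss \<ge> 2 \<Longrightarrow>
      (\<And>i. i < length ss \<Longrightarrow> Q (unbracket ss i)) \<Longrightarrow> Q (map Br ss)"
  shows "Q w"
  using assms(1)
proof (induction "size_list size w" arbitrary: w rule: less_induct)
  case less
  from less.prems show ?case
  proof (cases rule: Rey_cases_P)
    case (bracket ss)
    moreover have "Q (unbracket ss i)" if "i < length ss" for i
      using less.hyps[of "unbracket ss i"] bracket size_unbracket[OF that]
        unbracket_Rey[OF _ that] by simp
    ultimately show ?thesis using assms(3) by simp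
  qed (rule assms(2))
qed

section \<open>Linearity and range of the operator\<close>

lemma reynolds_P_eq_lin_ext: "reynolds_P = lin_ext (\<lambda>w. Pword (bword_of w))"
  by (intro ext) (simp add: reynolds_P_def lin_ext_def)

lemma linear_reynolds_P: "kR_linear reynolds_P"
  unfolding reynolds_P_eq_lin_ext by (rule linear_lin_ext)

lemma reynolds_P_monom: "w \<in> Rey \<Longrightarrow> reynolds_P (monom w) = Pword w"
  unfolding reynolds_P_eq_lin_ext by (rule lin_ext_monom)

text \<open>A word in \<open>Rey1\<close> is sent to a single bracket, and the recursion only forms
  linear combinations of earlier values and the bracket product itself.\<close>

lemma reynolds_P_in_bracket_span:
  fixes f :: "'x rword \<Rightarrow>\<^sub>0 'k::field"
  shows "reynolds_P f \<in> kR.span (monom ` bracket_words)"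
proof -
  let ?S = "kR.span (monom ` bracket_words) :: ('x rword \<Rightarrow>\<^sub>0 'k) set"
  have P: "Pword w \<in> ?S" if "w \<in> Rey" for w
    using that
  proof (induction w rule: Rey_induct_P)
    case (Rey1 w)
    then have "[Br w] \<in> bracket_words"
      by (intro IntI CollectI exI[of _ "[w]"]) (simp_all add: Rey_Br_iff)
    then show ?case using Rey1 by (simp only: Pword_Rey1 imageI kR.span_base)
  next
    case (bracket ss)
    have "ss \<noteq> []" using bracket.hyps(2) by auto
    then have "map Br ss \<in> bracket_words" using bracket.hyps(1) by blast
    then have w: "monom (map Br ss) \<in> ?S"
      by (intro kR.span_base imageI)
    have "(\<Sum>i<length ss. Pword (unbracket ss i)) \<in> ?S"
      by (rule kR.span_sum) (simp only: lessThan_iff bracket.IH)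
    with w show ?case
      unfolding Pword_bracket[OF bracket.hyps] by (simp only: kR.span_scale kR.span_diff)
  qed
  show ?thesis
    unfolding reynolds_P_def by (intro kR.span_sum kR.span_scale P bword_of)
qed

lemma bracket_span_mult:
  assumes "f \<in> kR.span (monom ` bracket_words)" "g \<in> kR.span (monom ` bracket_words)"
  shows "f * g \<in> kR.span (monom ` bracket_words)"
proof -
  let ?S = "kR.span (monom ` bracket_words)"
  have mm: "monom u * monom v \<in> ?S" if "u \<in> bracket_words" "v \<in> bracket_words" for u v
  proof -
    from that have "u @ v \<in> bracket_words"
      by (auto simp: Rey_append_iff simp flip: map_append)
    then show ?thesis using that by (auto simp flip: monom_append intro!: kR.span_base)
  qed
  have "monom u * g \<in> ?S" if "u \<in> bracket_words" for u
    using assms(2)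
  proof (induction rule: kR.span_induct_alt)
    case (step c x y)
    then show ?case using mm[OF that]
      by (auto simp: distrib_left kR.scale_mult_right intro!: kR.span_add kR.span_scale)
  qed (simp add: kR.span_zero)
  with assms(1) show ?thesis
    by (induction rule: kR.span_induct_alt)
      (auto simp: distrib_right kR.scale_mult_left kR.span_zero intro!: kR.span_add kR.span_scale)
qed

lemma reynolds_P_twist_bracket:
  fixes f :: "'x rword \<Rightarrow>\<^sub>0 'k::field_char_0"
  assumes "f \<in> kR.span (monom ` bracket_words)"
  shows "reynolds_P (twist f) = f"
proof -
  note P = linear_reynolds_P[unfolded kR_linear_iff]
  note T = linear_twist[unfolded kR_linear_iff]
  interpret P: Vector_Spaces.linear scale_kR scale_kR
      "reynolds_P :: ('x rword \<Rightarrow>\<^sub>0 'k) \<Rightarrow> ('x rword \<Rightarrow>\<^sub>0 'k)"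
    by (rule linear_reynolds_P)
  have mono: "reynolds_P (twist (monom w)) = (monom w :: 'x rword \<Rightarrow>\<^sub>0 'k)"
    if "w \<in> bracket_words" for w
  proof -
    from that obtain ss where w: "w = map Br ss" "map Br ss \<in> Rey" "ss \<noteq> []" by auto
    \<comment> \<open>The leading \<open>Pword w\<close> comes from the identity part of
      \<open>twist\<close>; with the last term it leaves \<open>-(m - 1)\<close> copies of
      \<open>Pword w\<close>, where \<open>m = length ss\<close>.\<close>
    have S: "reynolds_P (twist (monom w)) = Pword w + (\<Sum>i<length ss. Pword (unbracket ss i))
        - scale_kR (of_nat (length ss)) (Pword w :: 'x rword \<Rightarrow>\<^sub>0 'k)"
      using w unbracket_Rey[OF w(2)]
      by (simp add: twist_monom deriv_word_bracket P.add P.diff P.sum P.scale reynolds_P_monom)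
    show ?thesis
    proof (cases "length ss \<ge> 2")
      case True
      have "scale_kR (of_nat (length ss - 1)) (Pword w) =
          (\<Sum>i<length ss. Pword (unbracket ss i)) - (monom w :: 'x rword \<Rightarrow>\<^sub>0 'k)"
      proof -
        \<comment> \<open>Characteristic zero makes \<open>m - 1\<close> invertible, so the
          denominator in the recursion can be cleared.\<close>
        have "of_nat (length ss - 1) \<noteq> (0 :: 'k)" using True by simp
        then show ?thesis by (simp add: w(1) Pword_bracket[OF w(2) True] del: of_nat_diff)
      qed
      moreover have "scale_kR (of_nat (length ss)) (Pword w) =
          scale_kR (of_nat (length ss - 1)) (Pword w) + (Pword w :: 'x rword \<Rightarrow>\<^sub>0 'k)"
        using True kR.scale_left_distrib[of "of_nat (length ss - 1)" 1 "Pword w :: 'x rword \<Rightarrow>\<^sub>0 'k"]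
        by (simp add: of_nat_diff)
      ultimately show ?thesis using S by simp
    next
      case False
      \<comment> \<open>For a single bracket the recursion does not apply: \<open>twist\<close>
        strips the bracket, and since \<open>s\<close> lies in \<open>Rey1\<close>, \<open>P\<close>
        restores it.\<close>
      with w obtain s where "ss = [s]" by (cases ss; cases "tl ss") auto
      with S w show ?thesis using Rey_Br_iff[of s] by (simp add: Pword_Rey1)
    qed
  qed
  from assms show ?thesis
  proof (induction rule: kR.span_induct_alt)
    case base
    show ?case by (simp add: kR.linear_0[OF linear_twist] P.zero)
  next
    case (step c x y)
    from step(1) have "reynolds_P (twist x) = x" using mono by (elim imageE) simp
    with step(2) show ?case by (simp add: P T)
  qed
qed

lemma twist_reynolds_P:
  fixes f :: "'x rword \<Rightarrow>\<^sub>0 'k::field_char_0"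
  shows "twist (reynolds_P f) = f"
proof (rule kR_linear_eqI[of _ "\<lambda>f. f"])
  note P = linear_reynolds_P[unfolded kR_linear_iff]
  interpret T: Vector_Spaces.linear scale_kR scale_kR
      "twist :: ('x rword \<Rightarrow>\<^sub>0 'k) \<Rightarrow> ('x rword \<Rightarrow>\<^sub>0 'k)"
    by (rule linear_twist)
  show "kR_linear (\<lambda>f. twist (reynolds_P f) :: 'x rword \<Rightarrow>\<^sub>0 'k)"
    by (simp add: kR_linear_iff P T.add T.scale)
  show "kR_linear (\<lambda>f. f :: 'x rword \<Rightarrow>\<^sub>0 'k)"
    by (simp add: kR_linear_iff)
  fix w :: "'x bword" assume "w \<in> Rey"
  then have "twist (Pword w) = (monom w :: 'x rword \<Rightarrow>\<^sub>0 'k)"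
  proof (induction w rule: Rey_induct_P)
    case (Rey1 w)
    then show ?case using Rey_Br_iff[of w]
      by (simp add: Pword_Rey1 twist_monom monom_Nil)
  next
    case (bracket ss)
    let ?n = "of_nat (length ss) :: 'k" and ?w = "monom (map Br ss) :: 'x rword \<Rightarrow>\<^sub>0 'k"
    \<comment> \<open>By the induction hypothesis the left side is \<open>?n - 1\<close> times
      \<open>twist (Pword (map Br ss))\<close>, so the scalar on the right cancels the denominator
      in the recursion.\<close>
    have "(\<Sum>i<length ss. monom (unbracket ss i)) - twist ?w = scale_kR (?n - 1) ?w"
      using bracket.hyps
      by (simp add: twist_monom deriv_word_bracket kR.scale_left_diff_distrib)
    then show ?case
      using bracket.hyps
      by (simp add: Pword_bracket T.scale T.diff T.sum bracket.IH of_nat_diff)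
  qed
  then show "twist (reynolds_P (monom w)) = (monom w :: 'x rword \<Rightarrow>\<^sub>0 'k)"
    using \<open>w \<in> Rey\<close> by (simp add: reynolds_P_monom)
qed

section \<open>The Reynolds identity\<close>

theorem proposition3p7:
  shows "reynolds_algebra
    (scale_kR :: 'k::field_char_0 \<Rightarrow> ('x rword \<Rightarrow>\<^sub>0 'k) \<Rightarrow> ('x rword \<Rightarrow>\<^sub>0 'k))
    reynolds_P"
proof (intro reynolds_algebra.intro reynolds_algebra_axioms.intro kR.unital_algebra_axioms)
  show "kR_linear (reynolds_P :: ('x rword \<Rightarrow>\<^sub>0 'k) \<Rightarrow> ('x rword \<Rightarrow>\<^sub>0 'k))"
    by (rule linear_reynolds_P)
  then interpret P: Vector_Spaces.linear scale_kR scale_kR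
      "reynolds_P :: ('x rword \<Rightarrow>\<^sub>0 'k) \<Rightarrow> ('x rword \<Rightarrow>\<^sub>0 'k)" .
  fix u v :: "'x rword \<Rightarrow>\<^sub>0 'k"
  let ?P = "reynolds_P :: ('x rword \<Rightarrow>\<^sub>0 'k) \<Rightarrow> ('x rword \<Rightarrow>\<^sub>0 'k)"
  have "?P u * ?P v = ?P (twist (?P u * ?P v))"
    by (simp add: reynolds_P_twist_bracket bracket_span_mult reynolds_P_in_bracket_span)
  also have "\<dots> = ?P (u * ?P v) + ?P (?P u * v) - ?P (?P u * ?P v)"
    by (simp add: twist_mult twist_reynolds_P P.add P.diff)
  finally show "?P u * ?P v = ?P (u * ?P v) + ?P (?P u * v) - ?P (?P u * ?P v)" .
qed

end
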